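(* Let $b\geq 2$, $e\geq 1$, $h\geq 1$, $u\geq 1$ be integers. Write the base $b$ expansion $\sigma_{h,e,b}(u)=\sum_{i=0}^{n-1}a_{i}b^i$. If $a_{0}=a_1=\dots=a_{e+p_{e,b}}=b-1$ (that is, the rightmost $e+p_{e,b}+1$ base $b$ digits of $\sigma_{h,e,b}(u)$ are all equal to $b-1$), then $$S_{e,b}(\sigma_{h+1,e,b}(u))=\sigma_{h,e,b}(u).$$
   Context: For integers $b\ge 2$ and $e\ge 1$, $S_{e,b}$ is the function on positive integers sending $x=\sum_{i=0}^{n-1}a_i b^i$ (with digits $0\le a_i\le b-1$) to $S_{e,b}(x)=\sum_{i=0}^{n-1}a_i^e$. $S_{e,b}^{h}$ denotes the $h$-fold iterate, with $S_{e,b}^0(x)=x$. For a positive integer $u$ (the attractor), a positive integer $x$ is a height $h$, $u$ attracted number if $h$ is the smallest nonnegative integer with $S_{e,b}^h(x)=u$. $\sigma_{h,e,b}(u)$ denotes the smallest height $h$, $u$ attracted number, i.e. the smallest positive integer $k$ with $S_{e,b}^h(k)=u$ and $S_{e,b}^m(k)\neq u$ for all $0\le m<h$. $g(e)$ denotes the smallest integer such that every nonnegative integer can be written as $x_1^e+x_2^e+\dots+x_{g(e)}^e$ with $x_1,\dots,x_{g(e)}$ nonnegative integers (Waring's problem). $p_{e,b}$ denotes the smallest integer such that $b^{p_{e,b}}>g(e)$. In the expansion, $n$ is the number of base $b$ digits and $0\le a_i\le b-1$. *)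

theory Defs
  imports Complex_Main "HOL-Library.Extended_Nat"
begin

definition digit :: "nat \<Rightarrow> nat \<Rightarrow> nat \<Rightarrow> nat" where
  "digit b x i = x div b ^ i mod b"

definition num_digits :: "nat \<Rightarrow> nat \<Rightarrow> nat" where
  "num_digits b x = (LEAST n. x < b ^ n)"

definition S :: "nat \<Rightarrow> nat \<Rightarrow> nat \<Rightarrow> nat" where
  "S e b x = (\<Sum>i<num_digits b x. digit b x i ^ e)"

definition attracted :: "nat \<Rightarrow> nat \<Rightarrow> nat \<Rightarrow> nat \<Rightarrow> nat \<Rightarrow> bool" where
  "attracted h e b u x \<longleftrightarrow>
     x > 0 \<and> (S e b ^^ h) x = u \<and> (\<forall>m<h. (S e b ^^ m) x \<noteq> u)"

text \<open>For \<open>b \<ge> 2\<close>, \<open>e \<ge> 1\<close> and \<open>u \<ge> 1\<close> an attracted number of every height exists: from a number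
  \<open>x\<close> of height \<open>h\<close>, a number with \<open>x\<close> digits \<open>1\<close> and otherwise digits \<open>0\<close>, different from \<open>u\<close>,
  has height \<open>h + 1\<close>.\<close>

definition \<sigma> :: "nat \<Rightarrow> nat \<Rightarrow> nat \<Rightarrow> nat \<Rightarrow> nat" where
  "\<sigma> h e b u = (LEAST k. attracted h e b u k)"

definition sums_of_powers :: "nat \<Rightarrow> nat \<Rightarrow> bool" where
  "sums_of_powers e s \<longleftrightarrow> (\<forall>n::nat. \<exists>x::nat \<Rightarrow> nat. n = (\<Sum>i<s. x i ^ e))"

text \<open>The two minima below are taken in the extended naturals, where the infimum of a nonempty set
  is its least element and the infimum of the empty set is \<open>\<infinity>\<close>. By the Hilbert--Waring theorem
  both are finite for \<open>e \<ge> 1\<close> and \<open>b \<ge> 2\<close>, so they are the usual natural numbers; the extended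
  type only serves to make the definitions independent of that theorem.\<close>

definition waring_g :: "nat \<Rightarrow> enat" where
  "waring_g e = Inf {enat s | s. sums_of_powers e s}"

definition waring_p :: "nat \<Rightarrow> nat \<Rightarrow> enat" where
  "waring_p e b = Inf {enat p | p. enat (b ^ p) > waring_g e}"

lemma sum_digits_mod: "(\<Sum>i<n. digit b x i * b ^ i) = x mod b ^ n"
proof (induction n)
  case (Suc n)
  then show ?case
    using mod_mult2_eq[of x "b ^ n" b] by (simp add: digit_def mult.commute)
qed simp

lemma less_power_num_digits:
  assumes "b \<ge> 2"
  shows "x < b ^ num_digits b x"
proof -
  have "x < b ^ x"
    using assms by (intro power_gt_expt) simp
  then show ?thesis
    unfolding num_digits_def by (rule LeastI)
qed

lemma base_expansion:
  assumes "b \<ge> 2"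
  shows "x = (\<Sum>i<num_digits b x. digit b x i * b ^ i)"
  using less_power_num_digits[OF assms, of x] by (simp add: sum_digits_mod)

text \<open>Beyond the expansion all digits are \<open>0\<close>; hence prescribing the digits at positions \<open>i \<le> k\<close> to
  be \<open>b - 1 > 0\<close> entails that the expansion has more than \<open>k\<close> digits.\<close>

lemma digit_beyond:
  assumes "b \<ge> 2" "num_digits b x \<le> i"
  shows "digit b x i = 0"
proof -
  have "x < b ^ i"
    using less_power_num_digits[OF assms(1), of x] power_increasing[OF assms(2), of b] assms(1)
    by linarith
  then show ?thesis
    by (simp add: digit_def)
qed

end

theory Submission
  imports Defs
begin

text \<open>
  Write \<open>s\<close> and \<open>t\<close> for the smallest numbers of height \<open>h\<close> and \<open>h + 1\<close>, and \<open>p\<close> for \<open>p\<^sub>e\<^sub>,\<^sub>b\<close>. The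
  number \<open>y = S t\<close> has height \<open>h\<close>, so \<open>y \<ge> s\<close>. Suppose \<open>y > s\<close>.

  Since \<open>s\<close> ends in \<open>e + p + 1\<close> digits \<open>b - 1\<close>, a number \<open>y\<close> with \<open>s < y < s + b ^ (e + p)\<close> has digit
  \<open>0\<close> at position \<open>e + p\<close>. Exchanging that digit with the leading one yields a number below \<open>s\<close> with
  the same image under \<open>S\<close>, hence of height \<open>h\<close>, which contradicts the minimality of \<open>s\<close>. So
  \<open>y \<ge> s + b ^ (e + p)\<close>, which forces \<open>t\<close> to have many digits. But \<open>s\<close> is
  \<open>q * (b - 1) ^ e + r\<close> with \<open>r\<close> a sum of \<open>g\<close> powers of digits, so it is the image of a number with
  only \<open>q + g\<close> digits. That number is smaller than \<open>t\<close> and has height \<open>h + 1\<close>, a contradiction.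

  Both constructions could only fail by producing \<open>u\<close> itself. This is excluded because \<open>S z < M\<close> whenever
  \<open>z \<le> M\<close> and \<open>M \<ge> b ^ (e + p)\<close>, so that no cycle passes through so large a number.
\<close>

section \<open>Digit counts and the Waring constants\<close>

lemma num_digits_le: "x < b ^ n \<Longrightarrow> num_digits b x \<le> n"
  unfolding num_digits_def by (rule Least_le)

lemma power_num_digits_le:
  assumes "x > 0"
  shows "b ^ (num_digits b x - 1) \<le> x"
proof (cases "num_digits b x")
  case (Suc n)
  then have "\<not> x < b ^ n"
    using num_digits_le[of x b n] by auto
  with Suc show ?thesis by simp
qed (use assms in simp)

text \<open>Only 0 and 1 can occur in a representation of \<open>2 ^ e - 1\<close>, so it takes at
  least that many summands.\<close>

lemma sums_of_powers_lower_bound: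
  assumes "e \<ge> 1" "sums_of_powers e s"
  shows "2 ^ e \<le> s + 1"
proof -
  obtain x :: "nat \<Rightarrow> nat" where x: "2 ^ e - 1 = (\<Sum>i<s. x i ^ e)"
    using assms(2) unfolding sums_of_powers_def by blast
  have "x i ^ e \<le> 1" if "i < s" for i
  proof -
    have "x i ^ e \<le> (\<Sum>i<s. x i ^ e)"
      using that by (intro member_le_sum) auto
    then have "x i ^ e < 2 ^ e"
      unfolding x[symmetric] by (rule le_less_trans) simp
    then have "x i < 2"
      using power_less_imp_less_base[of "x i" e 2] by simp
    then show ?thesis using power_le_one[of "x i" e] by simp
  qed
  then have "(\<Sum>i<s. x i ^ e) \<le> (\<Sum>i<s. 1)"
    by (intro sum_mono) auto
  then have "2 ^ e - 1 \<le> s" using x by simp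
  then show ?thesis by linarith
qed

text \<open>The infimum of the empty set is \<infinity>, so a finite one is attained; this applies
  first to \<open>p\<close>, then to \<open>g\<close>.\<close>

lemma waring_p_finiteE:
  assumes "waring_p e b = enat p"
  obtains g where "sums_of_powers e g" "g < b ^ p"
proof -
  have Inf_mem: "Inf A \<in> A" if "A \<noteq> {}" for A :: "enat set"
    using that unfolding Inf_enat_def by (auto intro: LeastI)
  have ne: "{enat p | p. enat (b ^ p) > waring_g e} \<noteq> {}"
    using assms unfolding waring_p_def by (metis Inf_empty top_enat_def enat.distinct(1))
  have "enat (b ^ p) > waring_g e"
    using Inf_mem[OF ne] assms unfolding waring_p_def by auto
  then obtain g where g: "waring_g e = enat g" "g < b ^ p"
    by (metis enat_iless enat_ord_simps(2))
  have ne: "{enat s | s. sums_of_powers e s} \<noteq> {}"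
    using g(1) unfolding waring_g_def by (metis Inf_empty top_enat_def enat.distinct(1))
  have "sums_of_powers e g"
    using Inf_mem[OF ne] g(1) unfolding waring_g_def by auto
  with g(2) that show thesis by blast
qed

context
  fixes b e :: nat
  assumes b: "b \<ge> 2" and e: "e \<ge> 1"
begin

text \<open>Leading zeros contribute \<open>0 ^ e = 0\<close> because \<open>e \<ge> 1\<close>, so
  any sufficient length will do.\<close>

lemma S_eq_sum:
  assumes "x < b ^ n"
  shows "S e b x = (\<Sum>i<n. digit b x i ^ e)"
  unfolding S_def using digit_beyond[OF b] e num_digits_le[OF assms]
  by (intro sum.mono_neutral_left) auto

lemma S_0: "S e b 0 = 0"
  using S_eq_sum[of 0 0] by simp

lemma S_le: "x < b ^ n \<Longrightarrow> S e b x \<le> n * (b - 1) ^ e"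
proof -
  assume x: "x < b ^ n"
  have "digit b x i \<le> b - 1" for i
    using b pos_mod_bound[of b] by (simp add: digit_def less_Suc_eq_le[symmetric])
  then have "(\<Sum>i<n. digit b x i ^ e) \<le> (\<Sum>i<n. (b - 1) ^ e)"
    by (intro sum_mono power_mono) auto
  then show ?thesis using S_eq_sum[OF x] by simp
qed

lemma S_rec: "S e b x = (x mod b) ^ e + S e b (x div b)"
proof -
  define n where "n = num_digits b x"
  have x: "x < b ^ n" unfolding n_def by (rule less_power_num_digits[OF b])
  have 1: "x < b ^ Suc n" using x b by (simp add: less_le_trans[OF x])
  have 2: "x div b < b ^ n" using x by (rule le_less_trans[OF div_le_dividend])
  show ?thesis
    unfolding S_eq_sum[OF 1] S_eq_sum[OF 2]
    by (subst sum.lessThan_Suc_shift) (simp add: digit_def div_mult2_eq)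
qed

lemma S_digit: "d < b \<Longrightarrow> S e b d = d ^ e"
  using S_rec[of d] S_0 by simp

lemma S_append: "z < b ^ n \<Longrightarrow> S e b (a * b ^ n + z) = S e b a + S e b z"
proof (induction n arbitrary: z)
  case (Suc n)
  have eq: "a * b ^ Suc n + z = z + b * (a * b ^ n)" by simp
  have "(a * b ^ Suc n + z) mod b = z mod b"
    and "(a * b ^ Suc n + z) div b = a * b ^ n + z div b"
    unfolding eq using b by (simp_all add: div_mult_self2)
  moreover have "z div b < b ^ n"
    using Suc.prems b by (simp add: less_mult_imp_div_less mult.commute)
  ultimately show ?case
    using Suc.IH[of "z div b"] S_rec[of z] S_rec[of "a * b ^ Suc n + z"] by simp
qed (simp add: S_0)

lemma append_less_power:
  fixes d z :: nat
  assumes "d < b" "z < b ^ n"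
  shows "d * b ^ n + z < b ^ Suc n"
proof -
  have "(d + 1) * b ^ n \<le> b * b ^ n" using assms(1) by (intro mult_right_mono) auto
  then show ?thesis using assms(2) by simp
qed

lemma S_surj_on_digit_sums:
  assumes "\<And>i. i < n \<Longrightarrow> f i < b"
  shows "\<exists>z<b ^ n. S e b z = (\<Sum>i<n. f i ^ e)"
  using assms
proof (induction n)
  case 0
  then show ?case by (auto simp: S_0)
next
  case (Suc n)
  then obtain z where "z < b ^ n" "S e b z = (\<Sum>i<n. f i ^ e)" by auto
  then show ?case
    using append_less_power[of "f n" z n] S_append[of z n "f n"] S_digit[of "f n"] Suc.prems
    by (intro exI[of _ "f n * b ^ n + z"]) (auto simp: add.commute)
qed

section \<open>Attracted numbers and their minima\<close>

lemma funpow_S_0: "(S e b ^^ m) 0 = 0"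
  by (induction m) (auto simp: S_0)

text \<open>Positivity of \<open>S e b x\<close> is automatic: 0 is a fixed point and can never
  reach \<open>u \<ge> 1\<close>.\<close>

lemma attracted_Suc:
  assumes "u \<ge> 1"
  shows "attracted (Suc h) e b u x \<longleftrightarrow> x > 0 \<and> x \<noteq> u \<and> attracted h e b u (S e b x)"
proof -
  have "S e b x > 0" if "(S e b ^^ h) (S e b x) = u"
    using that assms funpow_S_0[of h] by (cases "S e b x") auto
  then show ?thesis
    unfolding attracted_def All_less_Suc2 funpow_Suc_right by auto
qed

lemma ex_attracted:
  assumes "u \<ge> 1"
  shows "\<exists>x. attracted h e b u x"
proof (induction h)
  case 0
  then show ?case using assms by (auto simp: attracted_def)
next
  case (Suc h)
  then obtain x where x: "attracted h e b u x" by blast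
  then have "x > 0" by (simp add: attracted_def)
  obtain z where z: "S e b z = x"
    using S_surj_on_digit_sums[of x "\<lambda>_. 1"] b by auto
  then have "z > 0" using \<open>x > 0\<close> S_0 by (cases z) auto
  \<comment> \<open>Appending a digit 0 gives a second preimage; at most one of the two is
    \<open>u\<close>.\<close>
  have "S e b (b * z) = x" using z b e S_rec[of "b * z"] by simp
  moreover have "b * z > 0" "b * z \<noteq> z" using \<open>z > 0\<close> b by auto
  ultimately show ?case
    using z x \<open>z > 0\<close> unfolding attracted_Suc[OF assms] by metis
qed

lemma attracted_\<sigma>: "u \<ge> 1 \<Longrightarrow> attracted h e b u (\<sigma> h e b u)"
  unfolding \<sigma>_def using ex_attracted LeastI_ex by metis

lemma \<sigma>_le: "attracted h e b u x \<Longrightarrow> \<sigma> h e b u \<le> x"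
  unfolding \<sigma>_def by (rule Least_le)

section \<open>Exchanging the leading digit with a lower zero\<close>

lemma digits_all_max:
  assumes "\<And>i. i < k \<Longrightarrow> digit b x i = b - 1"
  shows "x mod b ^ k = b ^ k - 1"
proof -
  have "x mod b ^ k = (\<Sum>i<k. (b - 1) * b ^ i)"
    using sum_digits_mod[where x = x and n = k and b = b] assms by simp
  also have "\<dots> = b ^ k - 1"
    using b by (induction k) (auto simp: algebra_simps diff_mult_distrib)
  finally show ?thesis .
qed

lemma leading_digit:
  assumes "x > 0"
  obtains d j r where "x = d * b ^ j + r" "r < b ^ j" "0 < d" "d < b"
proof -
  define j where "j = num_digits b x - 1"
  have j: "b ^ j \<le> x" unfolding j_def by (rule power_num_digits_le[OF assms])
  have "num_digits b x \<le> Suc j" unfolding j_def by simp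
  then have "b ^ num_digits b x \<le> b ^ Suc j" using b by (intro power_increasing) auto
  then have "x < b * b ^ j" using less_power_num_digits[OF b, of x] by simp
  then have "x div b ^ j < b" by (rule less_mult_imp_div_less)
  moreover have "x div b ^ j > 0" using j b by (simp add: div_greater_zero_iff)
  moreover have "x = x div b ^ j * b ^ j + x mod b ^ j" by (rule div_mult_mod_eq[symmetric])
  moreover have "x mod b ^ j < b ^ j" using b by simp
  ultimately show thesis using that by blast
qed

lemma smaller_same_S:
  fixes k s y u :: nat
  assumes s: "s mod b ^ Suc k = b ^ Suc k - 1" and y: "s < y" "y < s + b ^ k"
  shows "\<exists>y'. b ^ k \<le> y' \<and> y' < s \<and> S e b y' = S e b y"
proof -
  define T where "T = s div b ^ Suc k"
  have pos: "b ^ Suc k > 0" "b ^ k > 0" using b by auto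
  have "s = T * b ^ Suc k + s mod b ^ Suc k"
    unfolding T_def by (rule div_mult_mod_eq[symmetric])
  then have sT: "s + 1 = T * b ^ Suc k + b ^ Suc k"
    using s pos by linarith
  define z where "z = y - (s + 1)"
  \<comment> \<open>Adding 1 to \<open>s\<close> carries through all its final digits
    \<open>b - 1\<close>, which leaves \<open>T + 1\<close> above zeros; \<open>z\<close> is too
    small to reach position \<open>k\<close>.\<close>
  have yz: "y = (T + 1) * b ^ Suc k + z" and z: "z + 1 < b ^ k"
    using sT y unfolding z_def by (auto simp: algebra_simps)
  have bk: "2 * b ^ k \<le> b ^ Suc k" using b by simp
  obtain d j r where T: "T + 1 = d * b ^ j + r" and r: "r < b ^ j" and d: "0 < d" "d < b"
    using leading_digit[of "T + 1"] by auto
  have low: "d * b ^ k + z < b ^ Suc k"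
    using append_less_power[OF d(2)] z by simp
  \<comment> \<open>The leading digit \<open>d\<close> of \<open>T + 1\<close> moves down to the
    free position \<open>k\<close>.\<close>
  define y' where "y' = r * b ^ Suc k + (d * b ^ k + z)"
  have zk: "z < b ^ k" "z < b ^ Suc k" using z bk by linarith+
  have "S e b y' = S e b r + (S e b d + S e b z)"
    unfolding y'_def S_append[OF low] S_append[OF zk(1)] ..
  moreover have "S e b y = (S e b d + S e b r) + S e b z"
    unfolding yz T S_append[OF zk(2)] S_append[OF r] ..
  ultimately have "S e b y' = S e b y" by simp
  moreover have "1 * b ^ k \<le> d * b ^ k" using d by (intro mult_right_mono) auto
  then have "b ^ k \<le> y'" unfolding y'_def by linarith
  moreover have "y' < s"
  proof (cases "r < T")
    case True
    then have "(r + 1) * b ^ Suc k \<le> T * b ^ Suc k" by (intro mult_right_mono) auto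
    then show ?thesis unfolding y'_def using low sT pos bk by (simp add: algebra_simps)
  \<comment> \<open>Here the removed part \<open>d * b ^ j\<close> is just 1, so the digit moved to
    position \<open>k\<close> is 1.\<close>
  next
    case False
    have "d * b ^ j > 0" using d b by simp
    then have "r = T" "d * b ^ j = 1" using False T by linarith+
    moreover from this have "d = 1" by simp
    ultimately have "y' = T * b ^ Suc k + (b ^ k + z)" unfolding y'_def by simp
    then show ?thesis using sT z bk by linarith
  qed
  ultimately show ?thesis by blast
qed

section \<open>Growth bounds for S and small preimages\<close>

context
  fixes p g :: nat
  assumes g: "sums_of_powers e g" and p: "g < b ^ p"
begin

text \<open>Each step at most doubles the left side and multiplies the right side by
  \<open>b \<ge> 2\<close>. The base case rests on \<open>2 ^ e \<le> b ^ p\<close>.\<close>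

lemma digit_bound: "l \<ge> e + p + 1 \<Longrightarrow> l * (b - 1) ^ e < b ^ (l - 1)"
proof (induction l rule: dec_induct)
  case base
  have N: "2 ^ e \<le> b ^ p"
    using sums_of_powers_lower_bound[OF e g] p by linarith
  have "(2::nat) ^ e \<ge> 2 ^ 1" using e by (intro power_increasing) auto
  with N have "p \<ge> 1" by (cases p) auto
  show ?case
  proof (cases "b = 2")
    case True
    have *: "m + 1 < 2 ^ m" if "m \<ge> 2" for m :: nat
      using that by (induction m rule: dec_induct) auto
    then show ?thesis using True *[of "e + p"] e \<open>p \<ge> 1\<close> by simp
  next
    case False
    have *: "2 * m \<le> 2 ^ m" if "m \<ge> 1" for m :: nat
      using that by (induction m rule: dec_induct) auto
    have **: "2 * m + 1 \<le> 3 ^ m" for m :: nat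
      by (induction m) auto
    have "(3::nat) ^ p \<le> b ^ p" using False b by (intro power_mono) auto
    \<comment> \<open>Add \<open>2 * e \<le> b ^ p\<close> and \<open>2 * p + 1 \<le> b ^ p\<close>,
      then halve.\<close>
    then have "e + p + 1 \<le> b ^ p" using N *[OF e] **[of p] by linarith
    then have "(e + p + 1) * (b - 1) ^ e \<le> b ^ p * (b - 1) ^ e" by (intro mult_right_mono) auto
    also have "\<dots> < b ^ p * b ^ e"
      using b e by (intro mult_strict_left_mono power_strict_mono) auto
    finally show ?thesis by (simp add: power_add mult.commute)
  qed
next
  case (step l)
  have "1 * (b - 1) ^ e \<le> l * (b - 1) ^ e" using step by (intro mult_right_mono) auto
  then have "Suc l * (b - 1) ^ e \<le> 2 * (l * (b - 1) ^ e)" by simp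
  also have "\<dots> < 2 * b ^ (l - 1)" using step by simp
  also have "\<dots> \<le> b * b ^ (l - 1)" using b by simp
  also have "\<dots> = b ^ (Suc l - 1)" using step by (cases l) auto
  finally show ?case .
qed

lemma S_less:
  assumes "z \<le> M" "b ^ (e + p) \<le> M"
  shows "S e b z < M"
proof -
  \<comment> \<open>The maximum makes \<open>digit_bound\<close> applicable and still keeps
    \<open>b ^ (l - 1) \<le> M\<close>.\<close>
  define l where "l = max (num_digits b M) (e + p + 1)"
  have M: "M > 0" using assms(2) b by (metis gr0I le_zero_eq power_not_zero not_numeral_le_zero)
  have "b ^ num_digits b M \<le> b ^ l"
    using b by (intro power_increasing) (auto simp: l_def)
  then have "z < b ^ l"
    using assms(1) less_power_num_digits[OF b, of M] by linarith
  then have "S e b z \<le> l * (b - 1) ^ e" by (rule S_le)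
  also have "\<dots> < b ^ (l - 1)" by (rule digit_bound) (simp add: l_def)
  also have "\<dots> \<le> M"
    using assms(2) power_num_digits_le[OF M, of b] by (auto simp: l_def max_def)
  finally show ?thesis .
qed

lemma funpow_S_less:
  assumes "b ^ (e + p) \<le> M" "m \<ge> 1"
  shows "(S e b ^^ m) M < M"
  using assms(2)
proof (induction m rule: dec_induct)
  case base
  then show ?case using S_less[of M M] assms(1) by simp
next
  case (step m)
  then show ?case using S_less[of "(S e b ^^ m) M" M] assms(1) by simp
qed

lemma ex_preimage_below:
  assumes "s + b ^ (e + p) \<le> S e b t" "s > 0"
  shows "\<exists>x<t. x > 0 \<and> S e b x = s"
proof -
  define c where "c = (b - 1) ^ e"
  define q where "q = s div c"
  have c: "c > 0" "c < b ^ e" unfolding c_def using b e by (auto intro!: power_strict_mono)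
  obtain x where x: "s mod c = (\<Sum>i<g. x i ^ e)"
    using g unfolding sums_of_powers_def by blast
  have xb: "x i < b" if "i < g" for i
  proof -
    have "x i ^ e \<le> (\<Sum>i<g. x i ^ e)"
      using that by (intro member_le_sum) auto
    also have "\<dots> < (b - 1) ^ e" using c x unfolding c_def by (metis mod_less_divisor)
    \<comment> \<open>The remainder is below \<open>(b - 1) ^ e\<close>, so the Waring summands are
      powers of genuine digits.\<close>
    finally have "x i < b - 1" using power_less_imp_less_base[of "x i" e "b - 1"] by simp
    then show ?thesis by simp
  qed
  define f where "f i = (if i < q then b - 1 else x (i - q))" for i
  have "(\<Sum>i<q + g. f i ^ e) = (\<Sum>i<q. f i ^ e) + (\<Sum>i<g. f (q + i) ^ e)"
    by (induction g) auto
  also have "\<dots> = q * c + s mod c" by (simp add: f_def c_def flip: x)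
  also have "\<dots> = s" unfolding q_def by (rule div_mult_mod_eq)
  finally have sum: "(\<Sum>i<q + g. f i ^ e) = s" .
  have fb: "f i < b" if "i < q + g" for i
    using that xb[of "i - q"] b by (auto simp: f_def)
  obtain x' where x': "x' < b ^ (q + g)" "S e b x' = s"
    using S_surj_on_digit_sums[of "q + g" f, OF fb] sum by auto
  have "x' < t"
  proof (rule ccontr)
    assume "\<not> x' < t"
    \<comment> \<open>With so few digits, \<open>S e b t\<close> is at most
      \<open>q * c + g * c\<close>, which is below \<open>s + b ^ (e + p)\<close>.\<close>
    then have "t < b ^ (q + g)" using x' by linarith
    then have "S e b t \<le> (q + g) * c" unfolding c_def by (rule S_le)
    moreover have "g * c < b ^ p * b ^ e"
      using p c b by (intro mult_strict_mono) auto
    moreover have "q * c \<le> s" unfolding q_def by simp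
    ultimately show False using assms(1) by (simp add: algebra_simps power_add)
  qed
  moreover have "x' > 0" using x' assms(2) S_0 by (cases x') auto
  ultimately show ?thesis using x' by blast
qed

end

end

theorem theorem3p3:
  fixes b e h u :: nat
  assumes "b \<ge> 2" and "e \<ge> 1" and "h \<ge> 1" and "u \<ge> 1"
    and "\<forall>i. enat i \<le> enat e + waring_p e b \<longrightarrow> digit b (\<sigma> h e b u) i = b - 1"
  shows "S e b (\<sigma> (h + 1) e b u) = \<sigma> h e b u"
proof (rule ccontr)
  note be = assms(1,2) and u = assms(4)
  define s where "s = \<sigma> h e b u"
  define t where "t = \<sigma> (Suc h) e b u"
  define y where "y = S e b t"
  assume "S e b (\<sigma> (h + 1) e b u) \<noteq> \<sigma> h e b u"
  then have "y \<noteq> s" by (simp add: y_def t_def s_def)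
  have s: "attracted h e b u s" and t: "attracted (Suc h) e b u t"
    unfolding s_def t_def by (rule attracted_\<sigma>[OF be u])+
  from t have y: "attracted h e b u y"
    unfolding y_def attracted_Suc[OF be u] by simp
  with \<open>y \<noteq> s\<close> have "s < y"
    using \<sigma>_le[OF be] by (metis s_def le_neq_implies_less)
  \<comment> \<open>Otherwise the hypothesis prescribes \<open>b - 1\<close> even beyond the
    expansion, where digits are 0.\<close>
  have "waring_p e b \<noteq> \<infinity>"
  proof
    assume "waring_p e b = \<infinity>"
    then have "digit b s (num_digits b s) = b - 1" using assms(5) unfolding s_def by simp
    then show False using digit_beyond[OF assms(1)] assms(1) by simp
  qed
  then obtain p where p: "waring_p e b = enat p" by auto
  then obtain g where g: "sums_of_powers e g" "g < b ^ p" by (rule waring_p_finiteE)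
  note funpow_S_less = funpow_S_less[OF be g] and S_less = S_less[OF be g]
  have s_mod: "s mod b ^ Suc (e + p) = b ^ Suc (e + p) - 1"
    using assms(5) p unfolding s_def by (intro digits_all_max[OF be]) auto
  have "2 * b ^ (e + p) \<le> b ^ Suc (e + p)" "b ^ (e + p) > 0" using be by auto
  then have s_large: "b ^ (e + p) \<le> s"
    using mod_less_eq_dividend[of s "b ^ Suc (e + p)"] s_mod by linarith
  have "s + b ^ (e + p) \<le> y"
  proof (rule ccontr)
    assume "\<not> s + b ^ (e + p) \<le> y"
    then obtain y' where y': "b ^ (e + p) \<le> y'" "y' < s" "S e b y' = S e b y"
      using smaller_same_S[OF be s_mod \<open>s < y\<close>] by auto
    \<comment> \<open>Equal images under S suffice because \<open>h \<ge> 1\<close>.\<close>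
    have "(S e b ^^ h) y' = (S e b ^^ h) y"
      using y'(3) assms(3) by (cases h) (auto simp: funpow_swap1)
    then have "y' \<noteq> u"
      using funpow_S_less[OF y'(1) assms(3)] y by (auto simp: attracted_def)
    obtain h' where h': "h = Suc h'" using assms(3) by (cases h) auto
    have "y' > 0" using y'(1) be by (metis gr0I le_zero_eq power_not_zero not_numeral_le_zero)
    with y \<open>y' \<noteq> u\<close> have "attracted h e b u y'"
      unfolding h' attracted_Suc[OF be u] y'(3) by simp
    then show False using \<sigma>_le[OF be] y'(2) s_def by (metis not_less)
  qed
  then obtain x where x: "x < t" "x > 0" "S e b x = s"
    using ex_preimage_below[OF be g, of s t] s unfolding y_def attracted_def by auto
  have "(S e b ^^ h) s = u" using s by (simp add: attracted_def)
  \<comment> \<open>If \<open>x\<close> were \<open>u\<close>, then \<open>S e b u = s\<close>,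
    although \<open>u < s\<close> forces \<open>S e b u < s\<close>.\<close>
  then have "u < s" using funpow_S_less[OF s_large assms(3)] by simp
  then have "x \<noteq> u" using x(3) S_less[of u s] s_large by auto
  then have "attracted (Suc h) e b u x" using x s attracted_Suc[OF be u] by simp
  then show False using \<sigma>_le[OF be] x(1) t_def by (metis not_less)
qed

end
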